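(* Let $d\ge 1$, $\boldsymbol{k}=(k_1,\dots,k_d)\in\mathbb{N}_0^d$, $0\le c<d$, and $\boldsymbol{a},\boldsymbol{b}\in[d]^c$ be given and fixed, where $[d]=\{1,\dots,d\}$, $a_\ell<b_\ell$ for $\ell=1,\dots,c$ and $a_\ell<a_{\ell+1}$ for $\ell=1,\dots,c-1$. For each $q\in[d]$ let $z_{0,q},\dots,z_{k_q,q}\in[-1,1]$ be distinct nodes. Let $D_{\boldsymbol{a},\boldsymbol{b}}$ be the composed Duffy map, $E(\boldsymbol{a},\boldsymbol{b})=D_{\boldsymbol{a},\boldsymbol{b}}([-1,1]^d)$, and let $g_{\boldsymbol{a},\boldsymbol{b}}:[d]\to 2^{[d]}$ be the ancestor function (all defined in the context). Define the multi-index set $$A=\Big\{\boldsymbol{\alpha}\in\mathbb{N}_0^d \;\Big|\; \sum_{j\in g_{\boldsymbol{a},\boldsymbol{b}}(q)}\alpha_j\le k_q \text{ for every } q\in[d]\Big\},$$ which defines the polynomial space $$P=P(A)=\mathrm{span}\{\boldsymbol{\xi}^{\boldsymbol{\alpha}} \mid \boldsymbol{\alpha}\in A\}\subset Q_{\boldsymbol{k}}.$$ Then for every $p\in P$ (a polynomial in the variable $\boldsymbol{\xi}$), the barycentric evaluation procedure described in the context evaluates $p$ exactly: for every $\boldsymbol{\xi}\in E(\boldsymbol{a},\boldsymbol{b})$ and $\boldsymbol{\eta}\in[-1,1]^d$ with $D_{\boldsymbol{a},\boldsymbol{b}}(\boldsymbol{\eta})=\boldsymbol{\xi}$, the output $\mathcal{B}(\boldsymbol{\eta};(p_{\boldsymbol{j}})_{\boldsymbol{j}\le\boldsymbol{k}})$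 of the procedure, applied to the data $p_{\boldsymbol{j}}=p\big(D_{\boldsymbol{a},\boldsymbol{b}}(\boldsymbol{z}_{\boldsymbol{j}})\big)$, $\boldsymbol{j}\le\boldsymbol{k}$, equals $p(\boldsymbol{\xi})$.
   Context: Polynomials have real coefficients. Multi-index notation. For $\boldsymbol{\alpha}\in\mathbb{N}_0^d$, $\boldsymbol{\xi}^{\boldsymbol{\alpha}}=\prod_{q=1}^d\xi_q^{\alpha_q}$. Inequalities $\boldsymbol{j}\le\boldsymbol{k}$ between multi-indices in $\mathbb{N}_0^d$ are componentwise. $Q_{\boldsymbol{k}}=\mathrm{span}\{\boldsymbol{\eta}^{\boldsymbol{j}} \mid \boldsymbol{j}\in\mathbb{N}_0^d,\ \boldsymbol{j}\le\boldsymbol{k}\}$. Duffy maps. For $i\ne j$ in $[d]$, the map $D_{i,j}$ sends $\boldsymbol{\eta}$ to $\boldsymbol{\zeta}$ with $\zeta_i=\frac12(1+\eta_i)(1-\eta_j)-1$ and $\zeta_\ell=\eta_\ell$ for $\ell\ne i$. One sets $D_{\boldsymbol{a},\boldsymbol{b}}=D_{a_1,b_1}\circ D_{a_2,b_2}\circ\cdots\circ D_{a_c,b_c}$ (the identity if $c=0$), so $D_{a_c,b_c}$ is applied first. Ancestor function. Consider the directed graph on the vertex set $[d]$ with one edge from $b_\ell$ to $a_\ell$ for each $\ell=1,\dots,c$ (dimension $a_\ell$ is collapsed along dimension $b_\ell$). Since the $a_\ell$ are distinct and $a_\ell<b_\ell$, this is a forest. Define $g_{\boldsymbol{a},\boldsymbol{b}}(q)$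 to be the set consisting of $q$ together with all $i\in[d]$ for which there is a directed path from $q$ to $i$, i.e. all dimensions that collapse, directly or through a chain of collapses, onto $q$. For example, for $d=3$ and $(a_1,b_1)=(1,2)$, $(a_2,b_2)=(2,3)$ (tetrahedron): $g(1)=\{1\}$, $g(2)=\{1,2\}$, $g(3)=\{1,2,3\}$. Tensor grid. For $\boldsymbol{j}\le\boldsymbol{k}$, $\boldsymbol{z}_{\boldsymbol{j}}=(z_{j_1,1},z_{j_2,2},\dots,z_{j_d,d})\in[-1,1]^d$. Univariate barycentric evaluation. For direction $q$, define the weights $w_{q,j}=\prod_{0\le i\le k_q,\ i\ne j}(z_{i,q}-z_{j,q})^{-1}$, $0\le j\le k_q$. For $\boldsymbol{v}=(v_0,\dots,v_{k_q})$ and $y\in[-1,1]$ set $$B_q(\boldsymbol{v},y)=\frac{\sum_{j=0}^{k_q} \frac{w_{q,j}v_j}{y-z_{j,q}}}{\sum_{j=0}^{k_q}\frac{w_{q,j}}{y-z_{j,q}}}\quad\text{if } y\notin\{z_{0,q},\dots,z_{k_q,q}\},\qquad B_q(\boldsymbol{v},z_{j,q})=v_j .$$ Multivariate barycentric evaluation procedure. Given data $(p_{\boldsymbol{j}})_{\boldsymbol{j}\le\boldsymbol{k}}$ and $\boldsymbol{\eta}\in[-1,1]^d$, set $p^{[d]}_{\boldsymbol{j}}=p_{\boldsymbol{j}}$, and for $q=d,d-1,\dots,1$ define $$p^{[q-1]}_{(j_1,\dots,j_{q-1})}=B_q\Big(\big(p^{[q]}_{(j_1,\dots,j_{q-1},\ell)}\big)_{\ell=0}^{k_q},\,\eta_q\Big),\qquad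 0\le j_r\le k_r,\ 1\le r\le q-1 .$$ The output is the single number $\mathcal{B}(\boldsymbol{\eta};(p_{\boldsymbol{j}})_{\boldsymbol{j}\le\boldsymbol{k}})=p^{[0]}$. To evaluate a function $p$ at $\boldsymbol{\xi}\in E(\boldsymbol{a},\boldsymbol{b})$, the procedure takes the samples $p_{\boldsymbol{j}}=p(D_{\boldsymbol{a},\boldsymbol{b}}(\boldsymbol{z}_{\boldsymbol{j}}))$, a point $\boldsymbol{\eta}\in[-1,1]^d$ with $D_{\boldsymbol{a},\boldsymbol{b}}(\boldsymbol{\eta})=\boldsymbol{\xi}$, and outputs $\mathcal{B}(\boldsymbol{\eta};(p_{\boldsymbol{j}})_{\boldsymbol{j}\le\boldsymbol{k}})$. *)

theory Defs
  imports "HOL-Analysis.Analysis" "HOL-Library.Function_Algebras"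
begin

text \<open>
  A \<open>d\<close>-tuple is an extensional function on \<open>{1..d}\<close>, i.e. a member of
  \<open>{1..d} \<rightarrow>\<^sub>E S\<close>; in particular the empty tuple is \<open>\<lambda>_. undefined\<close>, and
  \<open>j(Suc q := l)\<close> appends the entry \<open>l\<close> to the \<open>q\<close>-tuple \<open>j\<close>.
  Node \<open>z\<^bsub>j,q\<^esub>\<close> is written \<open>z j q\<close>.
\<close>

definition cube :: "nat \<Rightarrow> (nat \<Rightarrow> real) set" where
  "cube d = {1..d} \<rightarrow>\<^sub>E {-1..1}"

definition multi_indices :: "nat \<Rightarrow> (nat \<Rightarrow> nat) set" where
  "multi_indices d = {1..d} \<rightarrow>\<^sub>E UNIV"


subsection \<open>Polynomial spaces\<close>

definition monomial :: "nat \<Rightarrow> (nat \<Rightarrow> nat) \<Rightarrow> (nat \<Rightarrow> real) \<Rightarrow> real" where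
  "monomial d \<alpha> \<xi> = (\<Prod>q\<in>{1..d}. \<xi> q ^ \<alpha> q)"

definition fun_scale :: "real \<Rightarrow> ('x \<Rightarrow> real) \<Rightarrow> 'x \<Rightarrow> real" where
  "fun_scale r f = (\<lambda>x. r * f x)"

lemma vector_space_fun_scale: "vector_space fun_scale"
  by unfold_locales (auto simp: fun_scale_def fun_eq_iff algebra_simps)

text \<open>Real polynomials in \<open>d\<close> variables are identified with the functions they define.\<close>

definition poly_space :: "nat \<Rightarrow> (nat \<Rightarrow> nat) set \<Rightarrow> ((nat \<Rightarrow> real) \<Rightarrow> real) set" where
  "poly_space d A = module.span fun_scale (monomial d ` A)"

definition Q_space :: "nat \<Rightarrow> (nat \<Rightarrow> nat) \<Rightarrow> ((nat \<Rightarrow> real) \<Rightarrow> real) set" where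
  "Q_space d k = poly_space d {j \<in> multi_indices d. \<forall>q\<in>{1..d}. j q \<le> k q}"


subsection \<open>Duffy maps and the ancestor function\<close>

definition duffy :: "nat \<Rightarrow> nat \<Rightarrow> (nat \<Rightarrow> real) \<Rightarrow> nat \<Rightarrow> real" where
  "duffy i j \<eta> = \<eta>(i := 1/2 * (1 + \<eta> i) * (1 - \<eta> j) - 1)"

primrec duffy_comp ::
  "(nat \<Rightarrow> nat) \<Rightarrow> (nat \<Rightarrow> nat) \<Rightarrow> nat \<Rightarrow> (nat \<Rightarrow> real) \<Rightarrow> nat \<Rightarrow> real" where
  "duffy_comp a b 0 = id"
| "duffy_comp a b (Suc c) = duffy_comp a b c \<circ> duffy (a (Suc c)) (b (Suc c))"

definition element ::
  "nat \<Rightarrow> (nat \<Rightarrow> nat) \<Rightarrow> (nat \<Rightarrow> nat) \<Rightarrow> nat \<Rightarrow> (nat \<Rightarrow> real) set" where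
  "element d a b c = duffy_comp a b c ` cube d"

definition collapse_edges :: "(nat \<Rightarrow> nat) \<Rightarrow> (nat \<Rightarrow> nat) \<Rightarrow> nat \<Rightarrow> (nat \<times> nat) set" where
  "collapse_edges a b c = {(b l, a l) | l. l \<in> {1..c}}"

definition ancestors ::
  "nat \<Rightarrow> (nat \<Rightarrow> nat) \<Rightarrow> (nat \<Rightarrow> nat) \<Rightarrow> nat \<Rightarrow> nat \<Rightarrow> nat set" where
  "ancestors d a b c q = insert q {i \<in> {1..d}. (q, i) \<in> (collapse_edges a b c)\<^sup>+}"

definition index_set ::
  "nat \<Rightarrow> (nat \<Rightarrow> nat) \<Rightarrow> (nat \<Rightarrow> nat) \<Rightarrow> (nat \<Rightarrow> nat) \<Rightarrow> nat \<Rightarrow> (nat \<Rightarrow> nat) set" where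
  "index_set d k a b c =
     {\<alpha> \<in> multi_indices d. \<forall>q\<in>{1..d}. (\<Sum>j\<in>ancestors d a b c q. \<alpha> j) \<le> k q}"


subsection \<open>Barycentric evaluation\<close>

text \<open>In one direction, with nodes \<open>x 0, \<dots>, x n\<close>.\<close>

definition bary_weight :: "(nat \<Rightarrow> real) \<Rightarrow> nat \<Rightarrow> nat \<Rightarrow> real" where
  "bary_weight x n j = (\<Prod>i\<in>{0..n} - {j}. inverse (x i - x j))"

definition bary1 :: "(nat \<Rightarrow> real) \<Rightarrow> nat \<Rightarrow> (nat \<Rightarrow> real) \<Rightarrow> real \<Rightarrow> real" where
  "bary1 x n v y =
     (if y \<in> x ` {0..n} then v (THE j. j \<in> {0..n} \<and> x j = y)
      else (\<Sum>j = 0..n. bary_weight x n j * v j / (y - x j)) /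
           (\<Sum>j = 0..n. bary_weight x n j / (y - x j)))"

definition grid_point :: "nat \<Rightarrow> (nat \<Rightarrow> nat \<Rightarrow> real) \<Rightarrow> (nat \<Rightarrow> nat) \<Rightarrow> nat \<Rightarrow> real" where
  "grid_point d z j = (\<lambda>q\<in>{1..d}. z (j q) q)"

text \<open>
  \<open>bary_eval z k \<eta> d p\<close> collapses the directions \<open>d, d - 1, \<dots>, 1\<close> in this order: a step
  turns the array \<open>p\<^sup>[\<^sup>q\<^sup>+\<^sup>1\<^sup>]\<close> of \<open>(q + 1)\<close>-tuples into the array \<open>p\<^sup>[\<^sup>q\<^sup>]\<close> of \<open>q\<close>-tuples.
  Only the values of \<open>p\<close> at multi-indices \<open>j \<le> k\<close> are used.
\<close>

primrec bary_eval ::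
  "(nat \<Rightarrow> nat \<Rightarrow> real) \<Rightarrow> (nat \<Rightarrow> nat) \<Rightarrow> (nat \<Rightarrow> real) \<Rightarrow> nat \<Rightarrow> ((nat \<Rightarrow> nat) \<Rightarrow> real) \<Rightarrow> real" where
  "bary_eval z k \<eta> 0 p = p (\<lambda>_. undefined)"
| "bary_eval z k \<eta> (Suc q) p =
     bary_eval z k \<eta> q
       (\<lambda>j. bary1 (\<lambda>i. z i (Suc q)) (k (Suc q)) (\<lambda>l. p (j(Suc q := l))) (\<eta> (Suc q)))"

end

theory Submission
  imports Defs "HOL-Computational_Algebra.Polynomial"
begin

text \<open>
  In the collapsed coordinates \<open>\<eta>\<close> the map \<open>D\<^bsub>a,b\<^esub>\<close> satisfies
  \<open>1 + \<xi>\<^bsub>a\<^esub> = (1 + \<eta>\<^bsub>a\<^esub>) (1 - \<xi>\<^bsub>b\<^esub>) / 2\<close> for each collapse of \<open>a\<close> along \<open>b\<close>, because the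
  ordering of the \<open>a\<close>'s makes the final value of \<open>\<xi>\<^bsub>b\<^esub>\<close> available when \<open>\<xi>\<^bsub>a\<^esub>\<close> is computed.
  Hence \<open>\<xi>\<^bsub>i\<^esub>\<close> has degree at most one in \<open>\<eta>\<^bsub>q\<^esub>\<close>, and degree zero unless \<open>i\<close> is an ancestor of
  \<open>q\<close>. A monomial \<open>\<xi>\<^sup>\<alpha>\<close> with \<open>\<alpha> \<in> A\<close> therefore has degree at most \<open>k\<^bsub>q\<^esub>\<close> in every \<open>\<eta>\<^bsub>q\<^esub>\<close>
  separately, so each univariate barycentric step is exact.
\<close>

subsection \<open>Univariate barycentric interpolation\<close>

text \<open>Both sides are polynomials in \<open>y\<close> of degree at most \<open>n\<close> that
  agree at \<open>n + 1\<close> distinct nodes. Without division by \<open>y - x j\<close>, the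
  identity also covers \<open>y\<close> at a node.\<close>

lemma lagrange_interpolation:
  fixes x :: "nat \<Rightarrow> real" and P :: "real poly"
  assumes inj: "inj_on x {0..n}" and deg: "degree P \<le> n"
  shows "(\<Sum>j = 0..n. poly P (x j) * bary_weight x n j * (\<Prod>i\<in>{0..n} - {j}. x i - y)) = poly P y"
proof -
  \<comment> \<open>\<open>[:x i, -1:]\<close> is \<open>x i - y\<close>, oriented as in
    \<open>bary_weight\<close>, so no sign \<open>(-1) ^ n\<close> appears.\<close>
  define Q where
    "Q = (\<Sum>j = 0..n. smult (poly P (x j) * bary_weight x n j) (\<Prod>i\<in>{0..n} - {j}. [:x i, -1:]))"
  have pQ: "poly Q t = (\<Sum>j = 0..n. poly P (x j) * bary_weight x n j * (\<Prod>i\<in>{0..n} - {j}. x i - t))" for t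
    by (simp add: Q_def poly_sum poly_prod)
  have "degree (smult (poly P (x j) * bary_weight x n j) (\<Prod>i\<in>{0..n} - {j}. [:x i, -1:])) \<le> n"
    if "j \<in> {0..n}" for j
  proof -
    have "degree (\<Prod>i\<in>{0..n} - {j}. [:x i, -1:]) \<le> (\<Sum>i\<in>{0..n} - {j}. degree [:x i, -1:])"
      using degree_prod_sum_le[of "{0..n} - {j}" "\<lambda>i. [:x i, -1:]"] by (simp add: comp_def)
    also have "\<dots> = n" using that by simp
    finally show ?thesis by (rule order_trans[OF degree_smult_le])
  qed
  then have dQ: "degree Q \<le> n" unfolding Q_def by (intro degree_sum_le) auto
  have node: "poly Q (x m) = poly P (x m)" if m: "m \<in> {0..n}" for m
  proof -
    have "(\<Prod>i\<in>{0..n} - {j}. x i - x m) = 0" if "j \<in> {0..n}" "j \<noteq> m" for j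
      using that m by (intro prod_zero) auto
    then have "poly Q (x m) = (\<Sum>j = 0..n. if j = m
        then poly P (x m) * (bary_weight x n m * (\<Prod>i\<in>{0..n} - {m}. x i - x m)) else 0)"
      unfolding pQ by (intro sum.cong) auto
    also have "\<dots> = poly P (x m) * (bary_weight x n m * (\<Prod>i\<in>{0..n} - {m}. x i - x m))"
      using m by simp
    also have "bary_weight x n m * (\<Prod>i\<in>{0..n} - {m}. x i - x m) = 1"
      unfolding bary_weight_def prod.distrib[symmetric]
      using inj m by (intro prod.neutral ballI left_inverse) (auto simp: inj_on_def)
    finally show ?thesis by simp
  qed
  have "Q = P"
  proof (rule poly_eqI_degree)
    show "poly Q t = poly P t" if "t \<in> x ` {0..n}" for t using that node by auto
    have "card (x ` {0..n}) = Suc n" using card_image[OF inj] by simp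
    then show "degree Q < card (x ` {0..n})" "degree P < card (x ` {0..n})" using dQ deg by auto
  qed
  then show ?thesis using pQ[of y] by simp
qed

lemma bary1_poly:
  assumes inj: "inj_on x {0..n}" and deg: "degree P \<le> n"
  shows "bary1 x n (\<lambda>l. poly P (x l)) y = poly P y"
proof (cases "y \<in> x ` {0..n}")
  case True
  then obtain m where m: "m \<in> {0..n}" "y = x m" by auto
  then have "(THE j. j \<in> {0..n} \<and> x j = y) = m"
    using inj by (intro the_equality) (auto simp: inj_on_def)
  then show ?thesis using True m by (simp add: bary1_def)
next
  case False
  define L where "L = (\<Prod>i = 0..n. x i - y)"
  have L: "L \<noteq> 0" using False by (auto simp: L_def)
  \<comment> \<open>Dividing the \<open>j\<close>-th Lagrange term by \<open>L\<close> leaves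
    \<open>1 / (x j - y)\<close>, hence the minus sign.\<close>
  have quot: "(\<Sum>j = 0..n. bary_weight x n j * poly R (x j) / (y - x j)) = - poly R y / L"
    if "degree R \<le> n" for R
  proof -
    have "bary_weight x n j * poly R (x j) / (y - x j)
        = - (poly R (x j) * bary_weight x n j * (\<Prod>i\<in>{0..n} - {j}. x i - y)) / L"
      if j: "j \<in> {0..n}" for j
    proof -
      have "L = (x j - y) * (\<Prod>i\<in>{0..n} - {j}. x i - y)"
        unfolding L_def using j by (intro prod.remove) auto
      moreover have "x j \<noteq> y" using False j by auto
      ultimately show ?thesis using L by (simp add: divide_simps) (simp add: algebra_simps)
    qed
    then show ?thesis
      by (simp add: sum_divide_distrib[symmetric] sum_negf lagrange_interpolation[OF inj that])
  qed
  \<comment> \<open>The denominator is the case of the constant polynomial 1, so the common factor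
    \<open>- 1 / L\<close> cancels.\<close>
  show ?thesis
    using False quot[OF deg] quot[of 1] L by (simp add: bary1_def)
qed

subsection \<open>Degrees in a single coordinate\<close>

text \<open>The other coordinates are frozen in \<open>\<eta>\<close>, and \<open>P\<close> may
  depend on them arbitrarily. Closure properties thus reduce to univariate polynomial
  arithmetic.\<close>

definition coord_degree_le :: "nat \<Rightarrow> nat \<Rightarrow> ((nat \<Rightarrow> real) \<Rightarrow> real) \<Rightarrow> bool" where
  "coord_degree_le q n f \<longleftrightarrow> (\<forall>\<eta>. \<exists>P. degree P \<le> n \<and> (\<forall>t. f (\<eta>(q := t)) = poly P t))"

lemma coord_degree_le_mono: "coord_degree_le q m f \<Longrightarrow> m \<le> n \<Longrightarrow> coord_degree_le q n f"
  unfolding coord_degree_le_def by (meson order_trans)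

lemma coord_degree_le_const: "coord_degree_le q n (\<lambda>_. r)"
  unfolding coord_degree_le_def by (auto intro!: exI[of _ "[:r:]"])

lemma coord_degree_le_coord: "coord_degree_le q (if i = q then 1 else 0) (\<lambda>\<eta>. \<eta> i)"
  unfolding coord_degree_le_def
proof
  fix \<eta> :: "nat \<Rightarrow> real"
  show "\<exists>P. degree P \<le> (if i = q then 1 else 0) \<and> (\<forall>t. (\<eta>(q := t)) i = poly P t)"
    by (cases "i = q") (auto intro: exI[of _ "[:0, 1:]"] exI[of _ "[:\<eta> i:]"])
qed

lemma coord_degree_le_add:
  assumes "coord_degree_le q n f" "coord_degree_le q n g"
  shows "coord_degree_le q n (\<lambda>\<eta>. f \<eta> + g \<eta>)"
  unfolding coord_degree_le_def
proof
  fix \<eta>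
  obtain P R where "degree P \<le> n" "\<forall>t. f (\<eta>(q := t)) = poly P t"
    "degree R \<le> n" "\<forall>t. g (\<eta>(q := t)) = poly R t"
    using assms unfolding coord_degree_le_def by meson
  then show "\<exists>S. degree S \<le> n \<and> (\<forall>t. f (\<eta>(q := t)) + g (\<eta>(q := t)) = poly S t)"
    by (intro exI[of _ "P + R"]) (auto intro: degree_add_le)
qed

lemma coord_degree_le_mult:
  assumes "coord_degree_le q m f" "coord_degree_le q n g"
  shows "coord_degree_le q (m + n) (\<lambda>\<eta>. f \<eta> * g \<eta>)"
  unfolding coord_degree_le_def
proof
  fix \<eta>
  obtain P R where "degree P \<le> m" "\<forall>t. f (\<eta>(q := t)) = poly P t"
    "degree R \<le> n" "\<forall>t. g (\<eta>(q := t)) = poly R t"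
    using assms unfolding coord_degree_le_def by meson
  then show "\<exists>S. degree S \<le> m + n \<and> (\<forall>t. f (\<eta>(q := t)) * g (\<eta>(q := t)) = poly S t)"
    by (intro exI[of _ "P * R"]) (auto intro: order_trans[OF degree_mult_le])
qed

lemma coord_degree_le_scale:
  "coord_degree_le q n f \<Longrightarrow> coord_degree_le q n (\<lambda>\<eta>. r * f \<eta>)"
  using coord_degree_le_mult[OF coord_degree_le_const[of q 0 r]] by simp

lemma coord_degree_le_power:
  "coord_degree_le q m f \<Longrightarrow> coord_degree_le q (e * m) (\<lambda>\<eta>. f \<eta> ^ e)"
  by (induction e) (auto intro: coord_degree_le_const coord_degree_le_mult)

lemma coord_degree_le_prod:
  assumes "finite I" "\<And>i. i \<in> I \<Longrightarrow> coord_degree_le q (m i) (f i)"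
  shows "coord_degree_le q (\<Sum>i\<in>I. m i) (\<lambda>\<eta>. \<Prod>i\<in>I. f i \<eta>)"
  using assms by (induction I) (auto intro: coord_degree_le_const coord_degree_le_mult)

text \<open>Filling the coordinates beyond \<open>d\<close> from \<open>\<eta>\<close> keeps the
  form of the data under induction: collapsing the last direction replaces its node by the entry of
  \<open>\<eta>\<close>.\<close>

lemma bary_eval_exact:
  assumes "\<forall>q\<in>{1..d}. inj_on (\<lambda>j. z j q) {0..k q}"
    and "\<forall>q\<in>{1..d}. coord_degree_le q (k q) F"
  shows "bary_eval z k \<eta> d (\<lambda>j. F (\<lambda>r. if r \<in> {1..d} then z (j r) r else \<eta> r)) = F \<eta>"
  using assms
proof (induction d)
  case 0
  then show ?case by simp
next
  case (Suc q)
  have "bary1 (\<lambda>i. z i (Suc q)) (k (Suc q))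
          (\<lambda>l. F (\<lambda>r. if r \<in> {1..Suc q} then z ((j(Suc q := l)) r) r else \<eta> r)) (\<eta> (Suc q))
        = F (\<lambda>r. if r \<in> {1..q} then z (j r) r else \<eta> r)" for j
  proof -
    define \<theta> where "\<theta> = (\<lambda>r. if r \<in> {1..q} then z (j r) r else \<eta> r)"
    have "coord_degree_le (Suc q) (k (Suc q)) F" using Suc.prems by simp
    then obtain P where P: "degree P \<le> k (Suc q)" "\<And>t. F (\<theta>(Suc q := t)) = poly P t"
      unfolding coord_degree_le_def by blast
    \<comment> \<open>As \<open>l\<close> varies, the data sample \<open>F\<close> at the nodes on
      the line through \<open>\<theta>\<close> in direction \<open>Suc q\<close>.\<close>
    have upd: "(\<lambda>r. if r \<in> {1..Suc q} then z ((j(Suc q := l)) r) r else \<eta> r)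
        = \<theta>(Suc q := z l (Suc q))" for l
      by (auto simp: \<theta>_def fun_eq_iff)
    have "\<theta>(Suc q := \<eta> (Suc q)) = \<theta>" by (auto simp: \<theta>_def fun_eq_iff)
    then have "poly P (\<eta> (Suc q)) = F \<theta>" using P(2)[of "\<eta> (Suc q)"] by simp
    moreover have "inj_on (\<lambda>i. z i (Suc q)) {0..k (Suc q)}" using Suc.prems by simp
    ultimately show ?thesis
      unfolding upd P(2) using bary1_poly[OF _ P(1)] by (simp add: \<theta>_def)
  qed
  then show ?case using Suc by simp
qed

subsection \<open>The composed Duffy map\<close>

text \<open>The right-hand side uses the final value at \<open>b l\<close>, not an intermediate one.
  The induction peels off the pair \<open>Suc c\<close>, which is applied first, so
  \<open>\<eta>\<close> must be arbitrary.\<close>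

lemma duffy_comp_unfold:
  assumes "\<forall>l\<in>{1..c}. a l < b l" and "\<forall>l\<in>{1..c}. \<forall>m\<in>{1..c}. l < m \<longrightarrow> a l < a m"
  shows "(\<forall>l\<in>{1..c}. duffy_comp a b c \<eta> (a l)
            = 1/2 * (1 + \<eta> (a l)) * (1 - duffy_comp a b c \<eta> (b l)) - 1) \<and>
         (\<forall>i. i \<notin> a ` {1..c} \<longrightarrow> duffy_comp a b c \<eta> i = \<eta> i)"
  using assms
proof (induction c arbitrary: \<eta>)
  case 0
  then show ?case by simp
next
  case (Suc c)
  define \<zeta> where "\<zeta> = duffy (a (Suc c)) (b (Suc c)) \<eta>"
  have IH: "\<forall>l\<in>{1..c}. duffy_comp a b c \<zeta> (a l)
              = 1/2 * (1 + \<zeta> (a l)) * (1 - duffy_comp a b c \<zeta> (b l)) - 1"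
    "\<forall>i. i \<notin> a ` {1..c} \<longrightarrow> duffy_comp a b c \<zeta> i = \<zeta> i"
    using Suc.IH[of \<zeta>] Suc.prems by simp_all
  have less: "\<forall>l\<in>{1..c}. a l < a (Suc c)" "a (Suc c) < b (Suc c)" using Suc.prems by auto
  \<comment> \<open>As \<open>b (Suc c)\<close> exceeds \<open>a (Suc c)\<close>, which exceeds all
    earlier \<open>a l\<close>, the maps applied later change neither coordinate.\<close>
  then have "a (Suc c) \<notin> a ` {1..c}" "b (Suc c) \<notin> a ` {1..c}" by fastforce+
  with IH(2) have "duffy_comp a b c \<zeta> (a (Suc c)) = \<zeta> (a (Suc c))"
    "duffy_comp a b c \<zeta> (b (Suc c)) = \<eta> (b (Suc c))"
    using less(2) by (simp_all add: \<zeta>_def duffy_def)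
  then have new: "duffy_comp a b c \<zeta> (a (Suc c))
      = 1/2 * (1 + \<eta> (a (Suc c))) * (1 - duffy_comp a b c \<zeta> (b (Suc c))) - 1"
    by (simp add: \<zeta>_def duffy_def)
  have old: "duffy_comp a b c \<zeta> (a l) = 1/2 * (1 + \<eta> (a l)) * (1 - duffy_comp a b c \<zeta> (b l)) - 1"
    if "l \<in> {1..c}" for l
  proof -
    \<comment> \<open>The case \<open>b l = a (Suc c)\<close> is harmless, since \<open>b l\<close>
      enters only through its final value.\<close>
    have "a l \<noteq> a (Suc c)" using less(1) that by fastforce
    then have "\<zeta> (a l) = \<eta> (a l)" by (simp add: \<zeta>_def duffy_def)
    then show ?thesis using IH(1) that by simp
  qed
  have rest: "duffy_comp a b c \<zeta> i = \<eta> i" if "i \<notin> a ` {1..Suc c}" for i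
  proof -
    have "i \<notin> a ` {1..c}" "i \<noteq> a (Suc c)" using that by auto
    then show ?thesis using IH(2) by (simp add: \<zeta>_def duffy_def)
  qed
  have "duffy_comp a b (Suc c) \<eta> = duffy_comp a b c \<zeta>" by (simp add: \<zeta>_def)
  then show ?case using new old rest by (auto simp: atLeastAtMostSuc_conv)
qed

text \<open>Each edge leads from \<open>b l\<close> to the smaller \<open>a l\<close>, so indices
  decrease along paths.\<close>

lemma ancestors_le:
  assumes "\<forall>l\<in>{1..c}. a l < b l" and "i \<in> ancestors d a b c q"
  shows "i \<le> q"
proof -
  have "j < p" if "(p, j) \<in> (collapse_edges a b c)\<^sup>+" for p j
    using that
  proof (induction rule: trancl_induct)
    case (base y)
    then show ?case using assms(1) by (auto simp: collapse_edges_def)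
  next
    case (step y i)
    then have "i < y" using assms(1) by (auto simp: collapse_edges_def)
    with step show ?case by simp
  qed
  then show ?thesis using assms(2) by (fastforce simp: ancestors_def)
qed

lemma ancestors_step:
  assumes "l \<in> {1..c}" "a l \<in> {1..d}" "b l \<in> ancestors d a b c q"
  shows "a l \<in> ancestors d a b c q"
proof -
  have "(b l, a l) \<in> collapse_edges a b c" using assms by (auto simp: collapse_edges_def)
  then show ?thesis using assms by (auto simp: ancestors_def intro: trancl_into_trancl)
qed

text \<open>The recursion expresses coordinate \<open>a l\<close> through coordinate
  \<open>b l\<close> of larger index, so the induction runs downwards from \<open>d\<close>.\<close>

lemma coord_degree_le_duffy_comp:
  assumes "\<forall>l\<in>{1..c}. a l \<in> {1..d} \<and> b l \<in> {1..d}"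
    and less: "\<forall>l\<in>{1..c}. a l < b l"
    and "\<forall>l\<in>{1..c}. \<forall>m\<in>{1..c}. l < m \<longrightarrow> a l < a m"
    and "i \<in> {1..d}"
  shows "coord_degree_le q (if i \<in> ancestors d a b c q then 1 else 0) (\<lambda>\<eta>. duffy_comp a b c \<eta> i)"
  using assms(4)
proof (induction "d - i" arbitrary: i rule: less_induct)
  case less': less
  note D = duffy_comp_unfold[OF less assms(3)]
  show ?case
  proof (cases "i \<in> a ` {1..c}")
    case False
    then have "(\<lambda>\<eta>. duffy_comp a b c \<eta> i) = (\<lambda>\<eta>. \<eta> i)" using D by auto
    then show ?thesis
      by (auto intro: coord_degree_le_mono[OF coord_degree_le_coord] simp: ancestors_def)
  next
    case True
    then obtain l where l: "l \<in> {1..c}" "i = a l" by auto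
    define m where "m = (if b l \<in> ancestors d a b c q then 1 else 0 :: nat)"
    have "i < b l" "b l \<in> {1..d}" using l less assms(1) by auto
    then have "coord_degree_le q m (\<lambda>\<eta>. duffy_comp a b c \<eta> (b l))"
      unfolding m_def by (intro less'.hyps) auto
    then have "coord_degree_le q m (\<lambda>\<eta>. 1 + (-1) * duffy_comp a b c \<eta> (b l))"
      by (intro coord_degree_le_add coord_degree_le_scale coord_degree_le_const)
    moreover have "coord_degree_le q (if i = q then 1 else 0) (\<lambda>\<eta>. 1/2 * (1 + \<eta> i))"
      by (intro coord_degree_le_add coord_degree_le_scale coord_degree_le_const coord_degree_le_coord)
    ultimately have "coord_degree_le q ((if i = q then 1 else 0) + m)
        (\<lambda>\<eta>. 1/2 * (1 + \<eta> i) * (1 + (-1) * duffy_comp a b c \<eta> (b l)) + (-1))"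
      by (intro coord_degree_le_add[OF coord_degree_le_mult coord_degree_le_const])
    moreover have "(\<lambda>\<eta>. duffy_comp a b c \<eta> i)
        = (\<lambda>\<eta>. 1/2 * (1 + \<eta> i) * (1 + (-1) * duffy_comp a b c \<eta> (b l)) + (-1))"
      using D l by (auto simp: fun_eq_iff)
    \<comment> \<open>The two factors never both involve \<open>\<eta> q\<close>: if
      \<open>i = q\<close>, then \<open>b l > q\<close> is no ancestor of \<open>q\<close>. If
      \<open>b l\<close> is an ancestor of \<open>q\<close>, so is \<open>i\<close>.\<close>
    moreover have "(if i = q then 1 else 0) + m \<le> (if i \<in> ancestors d a b c q then 1 else 0)"
    proof -
      have "b l \<notin> ancestors d a b c (a l)" using ancestors_le[OF less, of "b l" d "a l"] less l by fastforce
      moreover have "i \<in> ancestors d a b c q" if "b l \<in> ancestors d a b c q"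
        using ancestors_step[of l c a d b q] that l less'.prems by simp
      moreover have "q \<in> ancestors d a b c q" by (simp add: ancestors_def)
      ultimately show ?thesis using l by (auto simp: m_def)
    qed
    ultimately show ?thesis by (metis coord_degree_le_mono)
  qed
qed

theorem theorem4p1:
  fixes d c :: nat and k a b :: "nat \<Rightarrow> nat" and z :: "nat \<Rightarrow> nat \<Rightarrow> real"
  assumes "d \<ge> 1" and "c < d"
    and "\<forall>l\<in>{1..c}. a l \<in> {1..d} \<and> b l \<in> {1..d}"
    and "\<forall>l\<in>{1..c}. a l < b l"
    and "\<forall>l\<in>{1..<c}. a l < a (l + 1)"
    and "\<forall>q\<in>{1..d}. \<forall>j\<in>{0..k q}. z j q \<in> {-1..1}"
    and "\<forall>q\<in>{1..d}. inj_on (\<lambda>j. z j q) {0..k q}"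
  shows "poly_space d (index_set d k a b c) \<subseteq> Q_space d k \<and>
    (\<forall>p \<in> poly_space d (index_set d k a b c).
      \<forall>\<xi> \<in> element d a b c. \<forall>\<eta> \<in> cube d. duffy_comp a b c \<eta> = \<xi> \<longrightarrow>
        bary_eval z k \<eta> d (\<lambda>j. p (duffy_comp a b c (grid_point d z j))) = p \<xi>)"
proof -
  interpret vector_space fun_scale by (rule vector_space_fun_scale)
  have "a l < a m" if "l < m" "1 \<le> l" "m \<le> c" for l m
    using that
  proof (induction m)
    case (Suc m)
    then have "a m < a (Suc m)" using assms(5) by auto
    with Suc show ?case by (cases "l = m") auto
  qed simp
  then have mono: "\<forall>l\<in>{1..c}. \<forall>m\<in>{1..c}. l < m \<longrightarrow> a l < a m" by auto
  have sub: "ancestors d a b c q \<subseteq> {1..d}" if "q \<in> {1..d}" for q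
    using that by (auto simp: ancestors_def)
  have "\<alpha> q \<le> k q" if "\<alpha> \<in> index_set d k a b c" "q \<in> {1..d}" for \<alpha> q
  proof -
    \<comment> \<open>Since \<open>q\<close> is its own ancestor, \<open>\<alpha> q\<close> is one
      of the summands.\<close>
    have "\<alpha> q \<le> (\<Sum>j\<in>ancestors d a b c q. \<alpha> j)"
      using finite_subset[OF sub[OF that(2)]] by (intro member_le_sum) (auto simp: ancestors_def)
    also have "\<dots> \<le> k q" using that by (auto simp: index_set_def)
    finally show ?thesis .
  qed
  then have "poly_space d (index_set d k a b c) \<subseteq> Q_space d k"
    unfolding Q_space_def poly_space_def
    by (intro span_mono image_mono) (auto simp: index_set_def)
  moreover have "bary_eval z k \<eta> d (\<lambda>j. p (duffy_comp a b c (grid_point d z j))) = p (duffy_comp a b c \<eta>)"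
    if p: "p \<in> poly_space d (index_set d k a b c)" and \<eta>: "\<eta> \<in> cube d" for p \<eta>
  proof -
    \<comment> \<open>The degree bounds after composition with the Duffy map survive linear
      combinations, so checking the spanning monomials suffices.\<close>
    define S where
      "S = {f. \<forall>q\<in>{1..d}. coord_degree_le q (k q) (\<lambda>\<eta>. f (duffy_comp a b c \<eta>))}"
    have "subspace S"
      by (rule subspaceI)
        (auto simp: S_def fun_scale_def zero_fun_def plus_fun_def
          intro: coord_degree_le_const coord_degree_le_add coord_degree_le_scale)
    moreover have "monomial d \<alpha> \<in> S" if \<alpha>: "\<alpha> \<in> index_set d k a b c" for \<alpha>
    proof -
      have "coord_degree_le q (k q) (\<lambda>\<eta>. monomial d \<alpha> (duffy_comp a b c \<eta>))" if q: "q \<in> {1..d}" for q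
      proof -
        define m where "m i = (if i \<in> ancestors d a b c q then 1 else 0 :: nat)" for i
        have "coord_degree_le q (\<alpha> i * m i) (\<lambda>\<eta>. duffy_comp a b c \<eta> i ^ \<alpha> i)"
          if "i \<in> {1..d}" for i
          unfolding m_def
          by (rule coord_degree_le_power) (rule coord_degree_le_duffy_comp[OF assms(3,4) mono that])
        then have deg: "coord_degree_le q (\<Sum>i = 1..d. \<alpha> i * m i)
            (\<lambda>\<eta>. \<Prod>i = 1..d. duffy_comp a b c \<eta> i ^ \<alpha> i)"
          by (rule coord_degree_le_prod[OF finite_atLeastAtMost])
        \<comment> \<open>Only ancestors of \<open>q\<close> contribute to the degree in
          \<open>\<eta> q\<close>, which gives exactly the sum bounded in
          \<open>index_set\<close>.\<close>
        have "(\<Sum>i = 1..d. \<alpha> i * m i) = (\<Sum>j\<in>ancestors d a b c q. \<alpha> j)"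
          using sub[OF q] by (intro sum.mono_neutral_cong_right) (auto simp: m_def)
        also have "\<dots> \<le> k q" using \<alpha> q by (auto simp: index_set_def)
        finally show ?thesis
          unfolding monomial_def by (rule coord_degree_le_mono[OF deg])
      qed
      then show ?thesis by (simp add: S_def)
    qed
    ultimately have "poly_space d (index_set d k a b c) \<subseteq> S"
      unfolding poly_space_def by (intro span_minimal) auto
    then have "\<forall>q\<in>{1..d}. coord_degree_le q (k q) (\<lambda>\<eta>. p (duffy_comp a b c \<eta>))"
      using p by (auto simp: S_def)
    from bary_eval_exact[OF assms(7) this, of \<eta>]
    have "bary_eval z k \<eta> d (\<lambda>j. p (duffy_comp a b c (\<lambda>r. if r \<in> {1..d} then z (j r) r else \<eta> r)))
        = p (duffy_comp a b c \<eta>)" .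
    \<comment> \<open>Points of \<open>cube d\<close> are extensional, so \<open>\<eta>\<close> and
      the grid points agree outside \<open>{1..d}\<close>.\<close>
    moreover have "\<eta> r = undefined" if "r \<notin> {1..d}" for r
      using \<eta> that unfolding cube_def by (rule PiE_arb)
    then have "grid_point d z j = (\<lambda>r. if r \<in> {1..d} then z (j r) r else \<eta> r)" for j
      unfolding grid_point_def restrict_def by (intro ext) metis
    ultimately show ?thesis by simp
  qed
  ultimately show ?thesis by blast
qed

end
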